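(* Let $(\Omega, \mu)$ be a $\sigma$-finite measure space. Let $\phi \colon \Omega \to \mathbb{C}$ be measurable with essential range contained in the closed unit disc $\{\lambda\in\mathbb{C}: |\lambda|\le 1\}$. Let $1 \leq q \leq p < \infty$, and let $T$ be the multiplication operator induced by $\phi$ on $L^q(\Omega,\mu)$, i.e., $Tx = \phi x$ for $x \in L^q(\Omega,\mu)$. Let $\alpha \in (0,1)$. Then the following statements are equivalent: (i) $\|T^n(I-T)\| = O(n^{-\alpha})$ as $n \to \infty$. (ii) There exists a constant $C>0$ such that $$\sum_{n=1}^{\infty} n^{\alpha p-1} \|T^n (I-T)x\|^p \leq C \|x\|^p$$ for all $x \in L^q(\Omega,\mu)$.
   Context: $L^q(\Omega,\mu)$ is the space of complex-valued $q$-integrable functions. $a(n) = O(b(n))$ as $n\to\infty$ means there are constants $K>0$, $n_0$ with $a(n)\le K b(n)$ for all $n \ge n_0$. *)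

theory Defs
  imports "HOL-Analysis.Analysis" "HOL-Library.Landau_Symbols"
begin

text \<open>
  The space \<open>L\<^sup>q(M)\<close> is represented by the functions themselves rather than by
  their classes modulo almost-everywhere equality, so \<open>Lq_norm\<close> is a seminorm vanishing exactly
  on the null functions.
\<close>

definition Lq_space :: "'a measure \<Rightarrow> real \<Rightarrow> ('a \<Rightarrow> complex) set" where
  "Lq_space M q =
     {f \<in> borel_measurable M. integrable M (\<lambda>\<omega>. norm (f \<omega>) powr q)}"

definition Lq_norm :: "'a measure \<Rightarrow> real \<Rightarrow> ('a \<Rightarrow> complex) \<Rightarrow> real" where
  "Lq_norm M q f = (\<integral>\<omega>. norm (f \<omega>) powr q \<partial>M) powr (1 / q)"

text \<open>
  The analogue of \<^const>\<open>onorm\<close> for operators on \<open>L\<^sup>q(M)\<close>; null functions contribute \<open>0\<close>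
  since \<open>x / 0 = 0\<close>. As for \<^const>\<open>onorm\<close>, the value is meaningful only if the quotients are bounded.
\<close>

definition Lq_onorm ::
  "'a measure \<Rightarrow> real \<Rightarrow> (('a \<Rightarrow> complex) \<Rightarrow> ('a \<Rightarrow> complex)) \<Rightarrow> real" where
  "Lq_onorm M q S = (SUP f\<in>Lq_space M q. Lq_norm M q (S f) / Lq_norm M q f)"

definition ess_range :: "'a measure \<Rightarrow> ('a \<Rightarrow> complex) \<Rightarrow> complex set" where
  "ess_range M \<phi> =
     {z. \<forall>\<epsilon>>0. emeasure M {\<omega> \<in> space M. dist (\<phi> \<omega>) z < \<epsilon>} > 0}"

definition mult_op :: "('a \<Rightarrow> complex) \<Rightarrow> ('a \<Rightarrow> complex) \<Rightarrow> ('a \<Rightarrow> complex)" where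
  "mult_op \<phi> f = (\<lambda>\<omega>. \<phi> \<omega> * f \<omega>)"

end

theory Submission imports Defs begin

text \<open>
  For (i) \<open>\<Longrightarrow>\<close> (ii), testing on indicators gives \<open>|\<phi>|^n |1 - \<phi>| \<le> K n powr (-\<alpha>)\<close> almost everywhere, and
  \<open>n \<approx> 1 / (1 - |\<phi>|)\<close> turns this into \<open>|1 - \<phi>| \<le> K' (1 - |\<phi>|) powr \<alpha>\<close>. Since
  \<open>\<Sum>n. n powr (\<beta> - 1) r^n\<close> is \<open>O((1 - r) powr (-\<beta>))\<close>, the sum in (ii) is bounded pointwise,
  and Jensen's inequality with exponent \<open>p / q \<ge> 1\<close> for the measure \<open>|x| powr q d\<mu>\<close> carries the
  bound over to the norms. For (ii) \<open>\<Longrightarrow>\<close> (i), \<open>\<parallel>T^n (I - T) x\<parallel>\<close> is decreasing in \<open>n\<close>, so the first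
  \<open>N\<close> terms of the sum dominate a multiple of \<open>N powr (\<alpha> p) \<parallel>T^N (I - T) x\<parallel> powr p\<close>.
\<close>

section \<open>Values of a function and its essential range\<close>

text \<open>Every point outside the essential range is the centre of a ball with null preimage.
  These balls cover the complement of \<open>S\<close>, and by Lindelof countably many of them have
  the same union, so the exceptional set is a countable union of null sets.\<close>

lemma AE_in_closed_of_ess_range:
  assumes [measurable]: "\<phi> \<in> borel_measurable M"
    and "closed S" and "ess_range M \<phi> \<subseteq> S"
  shows "AE \<omega> in M. \<phi> \<omega> \<in> S"
proof -
  define F where "F = {ball z \<epsilon> |z \<epsilon>. {\<omega> \<in> space M. dist (\<phi> \<omega>) z < \<epsilon>} \<in> null_sets M}"
  have "\<And>U. U \<in> F \<Longrightarrow> open U"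
    by (auto simp: F_def)
  then obtain F' where F': "F' \<subseteq> F" "countable F'" "\<Union>F' = \<Union>F"
    by (rule Lindelof)
  have null: "AE \<omega> in M. \<phi> \<omega> \<notin> U" if mem: "U \<in> F'" for U
  proof -
    obtain z \<epsilon> where U: "U = ball z \<epsilon>" and N: "{\<omega> \<in> space M. dist (\<phi> \<omega>) z < \<epsilon>} \<in> null_sets M"
      using mem \<open>F' \<subseteq> F\<close> unfolding F_def by blast
    show ?thesis
      by (rule AE_I'[OF N]) (auto simp: U dist_commute)
  qed
  have "- S \<subseteq> \<Union>F"
  proof
    fix z assume "z \<in> - S"
    then have "z \<notin> ess_range M \<phi>" using assms by auto
    then obtain \<epsilon> where "\<epsilon> > 0" "\<not> emeasure M {\<omega> \<in> space M. dist (\<phi> \<omega>) z < \<epsilon>} > 0"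
      by (auto simp: ess_range_def)
    then have "{\<omega> \<in> space M. dist (\<phi> \<omega>) z < \<epsilon>} \<in> null_sets M"
      by (intro null_setsI) (auto simp: not_less)
    then show "z \<in> \<Union>F"
      using \<open>\<epsilon> > 0\<close> by (auto simp: F_def intro!: exI[of _ "ball z \<epsilon>"])
  qed
  then have cover: "- S \<subseteq> \<Union>F'" using F' by simp
  have "AE \<omega> in M. \<forall>U\<in>F'. \<phi> \<omega> \<notin> U"
    using F'(2) null by (simp add: AE_ball_countable)
  then show ?thesis
    by eventually_elim (use cover in auto)
qed

section \<open>Convexity of powers and Jensen's inequality\<close>

text \<open>The left side is the tangent at \<open>a\<close> to the convex function
  \<open>t powr s\<close>. It comes from Young's inequality for \<open>t powr s\<close> and
  \<open>a powr s\<close> with weights \<open>1/s\<close> and \<open>1 - 1/s\<close>, multiplied by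
  \<open>s\<close>; that inequality is applied to positive numbers, so \<open>t = 0\<close> is
  treated apart.\<close>

lemma powr_ge_tangent:
  fixes a t s :: real
  assumes "0 < a" "0 \<le> t" "1 \<le> s"
  shows "a powr s + s * a powr (s - 1) * (t - a) \<le> t powr s"
proof (cases "t = 0")
  case True
  have "a powr (s - 1) * a = a powr s"
    using assms by (simp add: powr_diff)
  then show ?thesis using True assms
    by (simp add: algebra_simps mult_le_cancel_right1 flip: mult.assoc)
next
  case False
  have "(t powr s) powr (1/s) * (a powr s) powr (1 - 1/s) \<le> 1/s * t powr s + (1 - 1/s) * a powr s"
    by (rule Youngs_inequality_0) (use assms False in auto)
  moreover have "(t powr s) powr (1/s) * (a powr s) powr (1 - 1/s) = t * a powr (s - 1)"
    using assms False by (simp add: powr_powr algebra_simps)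
  ultimately have "t * a powr (s - 1) \<le> 1/s * t powr s + (1 - 1/s) * a powr s" by simp
  then have "s * (t * a powr (s - 1)) \<le> s * (1/s * t powr s + (1 - 1/s) * a powr s)"
    using assms by (intro mult_left_mono) auto
  moreover have "a powr (s - 1) * a = a powr s"
    using assms by (simp add: powr_diff)
  ultimately show ?thesis
    using assms by (simp add: algebra_simps)
qed

text \<open>Jensen's inequality for the measure with density \<open>f\<close>. The total mass is not
  normalised to 1, which produces the factor with exponent \<open>s - 1\<close>.\<close>

lemma integral_mult_powr_le:
  fixes f g :: "'a \<Rightarrow> real"
  assumes "1 \<le> s" and "\<And>\<omega>. 0 \<le> f \<omega>" and "\<And>\<omega>. 0 \<le> g \<omega>"
    and f: "integrable M f" and gf: "integrable M (\<lambda>\<omega>. g \<omega> * f \<omega>)"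
    and gsf: "integrable M (\<lambda>\<omega>. g \<omega> powr s * f \<omega>)"
  shows "(\<integral>\<omega>. g \<omega> * f \<omega> \<partial>M) powr s
    \<le> (\<integral>\<omega>. f \<omega> \<partial>M) powr (s - 1) * (\<integral>\<omega>. g \<omega> powr s * f \<omega> \<partial>M)"
proof -
  define F where "F = (\<integral>\<omega>. f \<omega> \<partial>M)"
  define G where "G = (\<integral>\<omega>. g \<omega> * f \<omega> \<partial>M)"
  have nn: "0 \<le> F" "0 \<le> G" "0 \<le> (\<integral>\<omega>. g \<omega> powr s * f \<omega> \<partial>M)"
    unfolding F_def G_def using assms by (auto intro!: Bochner_Integration.integral_nonneg)
  \<comment> \<open>If \<open>F = 0\<close>, then \<open>f\<close> vanishes almost everywhere and
    \<open>G = 0\<close> follows. When \<open>G = 0\<close>, the left side is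
    \<open>0 powr s = 0\<close>.\<close>
  consider "G = 0" | "F > 0" "G > 0"
  proof (cases "F = 0")
    case True
    then have "AE \<omega> in M. f \<omega> = 0"
      using integral_nonneg_eq_0_iff_AE[OF f] assms by (simp add: F_def)
    then have "G = (\<integral>\<omega>. 0 \<partial>M)"
      unfolding G_def by (intro integral_cong_AE) (use gf in auto)
    then show ?thesis using that by simp
  qed (use nn that in force)
  then show ?thesis
  proof cases
    case 1
    then show ?thesis
      using nn by (simp add: G_def[symmetric] F_def[symmetric])
  next
    case 2
    \<comment> \<open>The tangent is taken at the weighted mean of \<open>g\<close>, so its linear
      part integrates to zero and only \<open>a powr s * F\<close> remains.\<close>
    define a where "a = G / F"
    have a: "a > 0" using 2 by (simp add: a_def)
    have "(\<integral>\<omega>. (a powr s - s * a powr (s - 1) * a) * f \<omega> + s * a powr (s - 1) * (g \<omega> * f \<omega>) \<partial>M)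
      \<le> (\<integral>\<omega>. g \<omega> powr s * f \<omega> \<partial>M)"
    proof (rule integral_mono)
      fix \<omega>
      have "(a powr s + s * a powr (s - 1) * (g \<omega> - a)) * f \<omega> \<le> g \<omega> powr s * f \<omega>"
        using powr_ge_tangent[OF a, of "g \<omega>" s] assms by (intro mult_right_mono) auto
      then show "(a powr s - s * a powr (s - 1) * a) * f \<omega> + s * a powr (s - 1) * (g \<omega> * f \<omega>)
          \<le> g \<omega> powr s * f \<omega>"
        by (simp add: algebra_simps)
    qed (use f gf gsf in auto)
    also have "(\<integral>\<omega>. (a powr s - s * a powr (s - 1) * a) * f \<omega> + s * a powr (s - 1) * (g \<omega> * f \<omega>) \<partial>M)
      = (a powr s - s * a powr (s - 1) * a) * F + s * a powr (s - 1) * G"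
      using f gf by (simp add: F_def G_def)
    also have "\<dots> = a powr s * F"
      using 2 by (simp add: a_def algebra_simps)
    finally have "F powr (s - 1) * (a powr s * F) \<le> F powr (s - 1) * (\<integral>\<omega>. g \<omega> powr s * f \<omega> \<partial>M)"
      by (intro mult_left_mono) auto
    moreover have "F powr (s - 1) * (a powr s * F) = G powr s"
      using 2 by (simp add: a_def powr_divide powr_diff)
    ultimately show ?thesis by (simp add: F_def G_def)
  qed
qed

section \<open>A power series bound, and the region cut out by the decay condition\<close>

text \<open>
  Up to constants, \<open>n powr (\<beta> - 1)\<close> is the \<open>n\<close>-th Taylor coefficient of
  \<open>(1 - r) powr (-\<beta>)\<close>, by Euler's limit formula for the Gamma function.
\<close>

lemma suminf_powr_mult_power_le:
  fixes \<beta> :: real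
  assumes "\<beta> > 0"
  obtains C where "C > 0" and "\<And>r. 0 \<le> r \<Longrightarrow> r < 1 \<Longrightarrow>
    (\<Sum>n. ennreal (real (Suc n) powr (\<beta> - 1) * r ^ Suc n)) \<le> ennreal (C * (1 - r) powr (-\<beta>))"
proof -
  have "Bseq (Gamma_series \<beta>)"
    by (intro convergent_imp_Bseq convergentI[OF Gamma_series_LIMSEQ])
  then obtain B where B: "B > 0" "\<And>n. \<bar>Gamma_series \<beta> n\<bar> \<le> B"
    by (auto elim!: BseqE)
  \<comment> \<open>The factor \<open>\<beta> + 1\<close> pays for the last factor of
    \<open>pochhammer \<beta> (Suc n)\<close>: for \<open>n > 0\<close>, \<open>\<beta> + n\<close>
    is at most \<open>(\<beta> + 1) * n\<close>, and this \<open>n\<close> lowers the exponent from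
    \<open>\<beta>\<close> to \<open>\<beta> - 1\<close>.\<close>
  define C where "C = B * (\<beta> + 1)"
  have poch: "pochhammer \<beta> n > 0" for n using assms by (simp add: pochhammer_pos)
  have coeff: "real n powr (\<beta> - 1) \<le> C * (pochhammer \<beta> n / fact n)" if "n > 0" for n
  proof -
    have "real n powr \<beta> * fact n / pochhammer \<beta> (Suc n) \<le> B"
      using B(2)[of n] that poch[of "Suc n"] by (simp add: Gamma_series_def powr_def mult.commute)
    then have "real n powr \<beta> \<le> B * pochhammer \<beta> n * (\<beta> + n) / fact n"
      using poch[of n] poch[of "Suc n"] by (simp add: field_simps pochhammer_Suc)
    also have "\<dots> \<le> B * pochhammer \<beta> n * ((\<beta> + 1) * n) / fact n"
    proof -
      have "\<beta> * 1 \<le> \<beta> * real n" using that assms by (intro mult_left_mono) auto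
      then have "\<beta> + n \<le> (\<beta> + 1) * n" by (simp add: algebra_simps)
      then show ?thesis
        using poch[of n] B by (intro divide_right_mono mult_left_mono) auto
    qed
    finally show ?thesis
      using that by (simp add: powr_diff C_def field_simps)
  qed
  show ?thesis
  proof (rule that)
    show "C > 0" using B assms by (simp add: C_def)
    fix r :: real assume r: "0 \<le> r" "r < 1"
    have "(\<lambda>n. ((-\<beta>) gchoose n) * (-r) ^ n) sums (1 + (-r)) powr (-\<beta>)"
      using r by (intro gen_binomial_real) auto
    also have "(\<lambda>n. ((-\<beta>) gchoose n) * (-r) ^ n) = (\<lambda>n. pochhammer \<beta> n / fact n * r ^ n)"
    proof
      fix n
      have "(-1 :: real) ^ n * (-1) ^ n = 1" by (simp flip: power_mult_distrib)
      then show "((-\<beta>) gchoose n) * (-r) ^ n = pochhammer \<beta> n / fact n * r ^ n"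
        unfolding gbinomial_pochhammer power_minus[of r] by (simp add: field_simps)
    qed
    finally have s: "(\<lambda>n. pochhammer \<beta> n / fact n * r ^ n) sums (1 - r) powr (-\<beta>)" by simp
    then have s': "(\<lambda>n. C * (pochhammer \<beta> n / fact n * r ^ n)) sums (C * (1 - r) powr (-\<beta>))"
      by (rule sums_mult)
    have nn: "0 \<le> C * (pochhammer \<beta> n / fact n * r ^ n)" for n
      using poch[of n] r \<open>C > 0\<close> by simp
    have "(\<Sum>n. ennreal (real (Suc n) powr (\<beta> - 1) * r ^ Suc n))
        \<le> (\<Sum>n. ennreal (C * (pochhammer \<beta> (Suc n) / fact (Suc n) * r ^ Suc n)))"
    proof (intro suminf_le ennreal_leI)
      fix n
      have "real (Suc n) powr (\<beta> - 1) * r ^ Suc n \<le> C * (pochhammer \<beta> (Suc n) / fact (Suc n)) * r ^ Suc n"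
        using r by (intro mult_right_mono coeff) auto
      then show "real (Suc n) powr (\<beta> - 1) * r ^ Suc n \<le> C * (pochhammer \<beta> (Suc n) / fact (Suc n) * r ^ Suc n)"
        by (simp only: mult.assoc)
    qed auto
    \<comment> \<open>The shifted sum omits only the nonnegative constant term of the
      series.\<close>
    also have "\<dots> \<le> (\<Sum>n. ennreal (C * (pochhammer \<beta> n / fact n * r ^ n)))"
      by (subst (2) suminf_offset[of _ 1]) auto
    also have "\<dots> = ennreal (C * (1 - r) powr (-\<beta>))"
      using s' nn by (intro suminf_ennreal_eq)
    finally show "(\<Sum>n. ennreal (real (Suc n) powr (\<beta> - 1) * r ^ Suc n)) \<le> ennreal (C * (1 - r) powr (-\<beta>))" .
  qed
qed

lemma norm_one_minus_le_powr:
  fixes K \<alpha> :: real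
  assumes "0 < \<alpha>" "0 < K" "0 < n\<^sub>0"
  obtains K' where "K' > 0" and "\<And>z :: complex. norm z \<le> 1 \<Longrightarrow>
    (\<And>n. n \<ge> n\<^sub>0 \<Longrightarrow> norm z ^ n * norm (1 - z) \<le> K * real n powr (-\<alpha>)) \<Longrightarrow>
    norm (1 - z) \<le> K' * (1 - norm z) powr \<alpha>"
proof -
  \<comment> \<open>The first entry serves \<open>N \<ge> n\<^sub>0\<close>: 2 comes from
    \<open>r ^ N \<ge> 1/2\<close> and 4 from \<open>y / 2 = 1 / (4 * (1 - r))\<close>. The second
    serves \<open>N < n\<^sub>0\<close>, where \<open>1 - r\<close> is at least
    \<open>1 / (2 * n\<^sub>0)\<close> and the trivial bound \<open>norm (1 - z) \<le> 2\<close> is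
    enough.\<close>
  define K' where "K' = max (2 * K * 4 powr \<alpha>) (2 * (2 * real n\<^sub>0) powr \<alpha>)"
  show ?thesis
  proof (rule that)
    show "K' > 0" using assms by (simp add: K'_def less_max_iff_disj)
    fix z :: complex
    assume z: "norm z \<le> 1"
      and decay: "\<And>n. n \<ge> n\<^sub>0 \<Longrightarrow> norm z ^ n * norm (1 - z) \<le> K * real n powr (-\<alpha>)"
    define r where "r = norm z"
    show "norm (1 - z) \<le> K' * (1 - norm z) powr \<alpha>"
    proof (cases "r = 1")
      case True
      \<comment> \<open>On the unit circle the powers do not decay, so letting n tend to infinity
        forces \<open>z = 1\<close>. This matches the claim, since
        \<open>0 powr \<alpha> = 0\<close>.\<close>
      have "((\<lambda>n. K * real n powr (-\<alpha>)) \<longlongrightarrow> K * 0) sequentially"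
        using assms by (intro tendsto_intros tendsto_neg_powr filterlim_real_sequentially) auto
      moreover have "eventually (\<lambda>n. norm (1 - z) \<le> K * real n powr (-\<alpha>)) sequentially"
        using decay True unfolding r_def by (auto simp: eventually_sequentially)
      ultimately have "norm (1 - z) \<le> K * 0"
        by (intro tendsto_lowerbound[of _ "K * 0"]) auto
      then show ?thesis using True by (simp add: r_def)
    next
      case False
      then have r: "0 \<le> r" "r < 1" using z by (auto simp: r_def)
      \<comment> \<open>Half of \<open>1 / (1 - r)\<close> is the scale at which Bernoulli's
        inequality still gives \<open>r ^ N \<ge> 1/2\<close>.\<close>
      define y where "y = 1 / (2 * (1 - r))"
      define N where "N = nat \<lfloor>y\<rfloor>"
      have y: "y > 0" using r by (simp add: y_def)
      have N: "real N \<le> y" "y < real N + 1"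
        using y unfolding N_def by linarith+
      show ?thesis
      proof (cases "n\<^sub>0 \<le> N")
        case True
        have "real N * (1 - r) \<le> y * (1 - r)" using N r by (intro mult_right_mono) auto
        also have "\<dots> = 1/2" using r by (simp add: y_def)
        finally have "1/2 \<le> 1 + real N * (r - 1)" by (simp add: algebra_simps)
        also have "\<dots> \<le> (1 + (r - 1)) ^ N" using r by (intro Bernoulli_inequality) auto
        finally have "1/2 \<le> r ^ N" by simp
        then have "1/2 * norm (1 - z) \<le> r ^ N * norm (1 - z)" by (intro mult_right_mono) auto
        also have "\<dots> \<le> K * real N powr (-\<alpha>)" using decay[OF True] by (simp add: r_def)
        also have "\<dots> \<le> K * (y / 2) powr (-\<alpha>)"
        proof -
          \<comment> \<open>Rounding down loses at most a factor 2:
            \<open>N \<ge> n\<^sub>0 \<ge> 1\<close> gives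
            \<open>y < N + 1 \<le> 2 * N\<close>.\<close>
          have "y / 2 \<le> real N" using N True assms by linarith
          then show ?thesis using y assms by (intro mult_left_mono powr_mono2') auto
        qed
        also have "(y / 2) powr (-\<alpha>) = 4 powr \<alpha> * (1 - r) powr \<alpha>"
        proof -
          have "y / 2 = inverse (4 * (1 - r))" by (simp add: y_def field_simps)
          then show ?thesis using r by (simp only: powr_minus inverse_powr powr_mult inverse_inverse_eq)
        qed
        finally have "norm (1 - z) \<le> (2 * K * 4 powr \<alpha>) * (1 - r) powr \<alpha>" by simp
        also have "\<dots> \<le> K' * (1 - r) powr \<alpha>" by (intro mult_right_mono) (auto simp: K'_def)
        finally show ?thesis by (simp add: r_def)
      next
        case False
        then have "y \<le> real n\<^sub>0" using N by linarith
        then have "1 \<le> 2 * real n\<^sub>0 * (1 - r)" using r by (simp add: y_def field_simps)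
        then have "1 \<le> (2 * real n\<^sub>0 * (1 - r)) powr \<alpha>" using assms by (simp add: ge_one_powr_ge_zero)
        also have "\<dots> = (2 * real n\<^sub>0) powr \<alpha> * (1 - r) powr \<alpha>" using r by (simp add: powr_mult)
        finally have "2 \<le> 2 * (2 * real n\<^sub>0) powr \<alpha> * (1 - r) powr \<alpha>" by simp
        also have "\<dots> \<le> K' * (1 - r) powr \<alpha>" by (intro mult_right_mono) (auto simp: K'_def)
        finally show ?thesis using norm_triangle_ineq4[of 1 z] z by (simp add: r_def)
      qed
    qed
  qed
qed

section \<open>Multiplication operators on \<open>Lq_space\<close> and their norms\<close>

lemma mult_op_measurable:
  assumes "m \<in> borel_measurable M" "f \<in> borel_measurable M"
  shows "mult_op m f \<in> borel_measurable M"
  using assms by (simp add: mult_op_def)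

lemma norm_mult_op_powr: "norm (mult_op m f \<omega>) powr q = norm (m \<omega>) powr q * norm (f \<omega>) powr q"
  by (simp add: mult_op_def norm_mult powr_mult)

lemma Lq_norm_nonneg: "0 \<le> Lq_norm M q f"
  by (simp add: Lq_norm_def)

lemma Lq_norm_powr:
  assumes "q > 0"
  shows "Lq_norm M q f powr p = (\<integral>\<omega>. norm (f \<omega>) powr q \<partial>M) powr (p / q)"
  using assms by (simp add: Lq_norm_def powr_powr)

lemma mult_op_in_Lq_space:
  assumes "m \<in> borel_measurable M" and "AE \<omega> in M. norm (m \<omega>) \<le> B" and "0 \<le> q"
    and f: "f \<in> Lq_space M q"
  shows "mult_op m f \<in> Lq_space M q"
proof -
  have [measurable]: "m \<in> borel_measurable M" "f \<in> borel_measurable M"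
    using assms by (auto simp: Lq_space_def)
  have "integrable M (\<lambda>\<omega>. norm (mult_op m f \<omega>) powr q)"
  proof (rule Bochner_Integration.integrable_bound)
    show "integrable M (\<lambda>\<omega>. B powr q * norm (f \<omega>) powr q)"
      using f by (simp add: Lq_space_def)
    show "AE \<omega> in M. norm (norm (mult_op m f \<omega>) powr q) \<le> norm (B powr q * norm (f \<omega>) powr q)"
      using assms(2)
      by eventually_elim (use assms(3) in \<open>auto simp: norm_mult_op_powr intro!: mult_right_mono powr_mono2\<close>)
  qed (simp add: norm_mult_op_powr)
  then show ?thesis
    by (simp add: Lq_space_def mult_op_measurable)
qed

lemma Lq_norm_mono:
  assumes "q > 0" and "f \<in> Lq_space M q" "g \<in> Lq_space M q"
    and le: "AE \<omega> in M. norm (f \<omega>) \<le> norm (g \<omega>)"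
  shows "Lq_norm M q f \<le> Lq_norm M q g"
proof -
  have "(\<integral>\<omega>. norm (f \<omega>) powr q \<partial>M) \<le> (\<integral>\<omega>. norm (g \<omega>) powr q \<partial>M)"
  proof (rule integral_mono_AE)
    show "AE \<omega> in M. norm (f \<omega>) powr q \<le> norm (g \<omega>) powr q"
      using le by eventually_elim (use assms in \<open>auto intro!: powr_mono2\<close>)
  qed (use assms in \<open>auto simp: Lq_space_def\<close>)
  then show ?thesis
    unfolding Lq_norm_def using assms by (intro powr_mono2) auto
qed

lemma Lq_norm_mult_op_const:
  assumes "q > 0"
  shows "Lq_norm M q (mult_op (\<lambda>_. c) f) = norm c * Lq_norm M q f"
  using assms
  by (simp add: Lq_norm_def norm_mult_op_powr powr_mult powr_powr)

lemma Lq_norm_mult_op_le: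
  assumes "m \<in> borel_measurable M" and le: "AE \<omega> in M. norm (m \<omega>) \<le> B" and "0 \<le> B" and "q > 0"
    and f: "f \<in> Lq_space M q"
  shows "Lq_norm M q (mult_op m f) \<le> B * Lq_norm M q f"
proof -
  have "Lq_norm M q (mult_op m f) \<le> Lq_norm M q (mult_op (\<lambda>_. complex_of_real B) f)"
  proof (rule Lq_norm_mono)
    show "AE \<omega> in M. norm (mult_op m f \<omega>) \<le> norm (mult_op (\<lambda>_. complex_of_real B) f \<omega>)"
      using le by eventually_elim
        (use \<open>0 \<le> B\<close> in \<open>auto simp: mult_op_def norm_mult intro!: mult_right_mono\<close>)
  qed (use assms in \<open>auto intro!: mult_op_in_Lq_space\<close>)
  then show ?thesis
    using assms by (simp add: Lq_norm_mult_op_const)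
qed

text \<open>On a set of positive finite measure where \<open>norm (m \<omega>) > K\<close>, the
  operator would stretch the indicator by more than \<open>K\<close>. Sigma-finiteness cuts the
  space into countably many pieces of finite measure on which this test is possible. The bound
  \<open>B\<close> keeps the image in \<open>Lq_space\<close>, so that its integral is not the
  default value 0.\<close>

lemma AE_norm_le_of_Lq_norm_mult_op_le:
  assumes "sigma_finite_measure M" and [measurable]: "m \<in> borel_measurable M"
    and bdd: "AE \<omega> in M. norm (m \<omega>) \<le> B" and "0 \<le> K" and "q > 0"
    and le: "\<And>f. f \<in> Lq_space M q \<Longrightarrow> Lq_norm M q (mult_op m f) \<le> K * Lq_norm M q f"
  shows "AE \<omega> in M. norm (m \<omega>) \<le> K"
proof -
  interpret sigma_finite_measure M by fact
  obtain A :: "nat \<Rightarrow> 'a set"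
    where A: "range A \<subseteq> sets M" "(\<Union>i. A i) = space M" "\<And>i. emeasure M (A i) \<noteq> \<infinity>"
    using sigma_finite by blast
  have "AE \<omega> in M. \<omega> \<in> A i \<longrightarrow> norm (m \<omega>) \<le> K" for i
  proof -
    define B' where "B' = A i \<inter> {\<omega> \<in> space M. norm (m \<omega>) > K}"
    have [measurable]: "A i \<in> sets M" using A by auto
    have B' [measurable]: "B' \<in> sets M" unfolding B'_def by measurable
    have fin: "emeasure M B' < \<infinity>"
      using emeasure_mono[of B' "A i" M] A(3)[of i] by (auto simp: B'_def less_top top_unique)
    define f :: "'a \<Rightarrow> complex" where "f = indicator B'"
    have fq: "norm (f \<omega>) powr q = indicator B' \<omega>" for \<omega>
      by (simp add: f_def indicator_def)
    have f: "f \<in> Lq_space M q"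
    proof -
      have "integrable M (\<lambda>\<omega>. norm (f \<omega>) powr q)" using fin by (simp add: fq)
      then show ?thesis by (simp add: Lq_space_def f_def)
    qed
    have mf: "mult_op m f \<in> Lq_space M q"
      by (rule mult_op_in_Lq_space[OF _ bdd]) (use f \<open>q > 0\<close> in auto)
    have int1: "integrable M (\<lambda>\<omega>. norm (m \<omega>) powr q * indicator B' \<omega>)"
      using mf by (simp add: Lq_space_def norm_mult_op_powr fq)
    have int2: "integrable M (\<lambda>\<omega>. K powr q * indicator B' \<omega>)"
      using fin by simp
    have "Lq_norm M q (mult_op m f) powr q \<le> (K * Lq_norm M q f) powr q"
      using le[OF f] \<open>q > 0\<close> by (intro powr_mono2) (auto simp: Lq_norm_nonneg)
    also have "\<dots> = K powr q * Lq_norm M q f powr q"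
      by (simp add: powr_mult Lq_norm_nonneg \<open>0 \<le> K\<close>)
    finally have "(\<integral>\<omega>. norm (m \<omega>) powr q * indicator B' \<omega> \<partial>M) \<le> (\<integral>\<omega>. K powr q * indicator B' \<omega> \<partial>M)"
      using \<open>q > 0\<close> by (simp add: Lq_norm_powr norm_mult_op_powr fq)
    then have le0: "(\<integral>\<omega>. norm (m \<omega>) powr q * indicator B' \<omega> - K powr q * indicator B' \<omega> \<partial>M) \<le> 0"
      using int1 int2 by (subst Bochner_Integration.integral_diff) auto
    have pos: "0 \<le> norm (m \<omega>) powr q * indicator B' \<omega> - K powr q * indicator B' \<omega>" for \<omega>
      using \<open>q > 0\<close> \<open>0 \<le> K\<close> by (auto simp: B'_def indicator_def intro!: powr_mono2)
    \<comment> \<open>The integrand is nonnegative with integral at most 0, hence zero almost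
      everywhere, although it is strictly positive on \<open>B'\<close>.\<close>
    have "(\<integral>\<omega>. norm (m \<omega>) powr q * indicator B' \<omega> - K powr q * indicator B' \<omega> \<partial>M) = 0"
      using le0 pos by (intro antisym Bochner_Integration.integral_nonneg) auto
    then have "AE \<omega> in M. norm (m \<omega>) powr q * indicator B' \<omega> - K powr q * indicator B' \<omega> = 0"
      by (subst (asm) integral_nonneg_eq_0_iff_AE)
        (use int1 int2 pos in \<open>auto intro!: Bochner_Integration.integrable_diff\<close>)
    then show ?thesis
    proof (rule AE_mp, intro AE_I2 impI)
      fix \<omega> assume \<omega>: "\<omega> \<in> space M" "\<omega> \<in> A i"
        and eq: "norm (m \<omega>) powr q * indicator B' \<omega> - K powr q * indicator B' \<omega> = 0"
      show "norm (m \<omega>) \<le> K"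
      proof (rule ccontr)
        assume "\<not> norm (m \<omega>) \<le> K"
        then have "\<omega> \<in> B'" "K powr q < norm (m \<omega>) powr q"
          using \<omega> \<open>q > 0\<close> \<open>0 \<le> K\<close> by (auto simp: B'_def intro!: powr_less_mono2)
        then show False using eq by simp
      qed
    qed
  qed
  then have "AE \<omega> in M. \<forall>i. \<omega> \<in> A i \<longrightarrow> norm (m \<omega>) \<le> K"
    by (subst AE_all_countable) blast
  then show ?thesis
    by (rule AE_mp) (use A(2) in \<open>auto intro!: AE_I2\<close>)
qed

text \<open>A real supremum can be used only over a set that is bounded above; the almost-everywhere
  bound \<open>B\<close> on the multiplier provides this.\<close>

lemma
  assumes "m \<in> borel_measurable M" and bdd: "AE \<omega> in M. norm (m \<omega>) \<le> B" and "0 \<le> B" and "q > 0"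
  shows Lq_onorm_mult_op_nonneg: "0 \<le> Lq_onorm M q (mult_op m)"
    and Lq_norm_mult_op_le_onorm: "\<And>f. f \<in> Lq_space M q \<Longrightarrow>
      Lq_norm M q (mult_op m f) \<le> Lq_onorm M q (mult_op m) * Lq_norm M q f"
proof -
  note le = Lq_norm_mult_op_le[OF assms]
  have above: "bdd_above ((\<lambda>f. Lq_norm M q (mult_op m f) / Lq_norm M q f) ` Lq_space M q)"
  proof (rule bdd_aboveI2)
    fix f assume "f \<in> Lq_space M q"
    then show "Lq_norm M q (mult_op m f) / Lq_norm M q f \<le> B"
      using le[of f] Lq_norm_nonneg[of M q f] \<open>0 \<le> B\<close>
      by (cases "Lq_norm M q f = 0") (auto simp: divide_le_eq)
  qed
  note upper = cSUP_upper[OF _ above, folded Lq_onorm_def]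
  have "(\<lambda>_. 0) \<in> Lq_space M q" by (simp add: Lq_space_def)
  from upper[OF this] show "0 \<le> Lq_onorm M q (mult_op m)"
    by (rule order_trans[rotated]) (simp add: Lq_norm_nonneg)
  fix f assume f: "f \<in> Lq_space M q"
  \<comment> \<open>For a null function the quotient is 0 by convention and carries no information,
    so that case falls back on the bound by \<open>B\<close>.\<close>
  show "Lq_norm M q (mult_op m f) \<le> Lq_onorm M q (mult_op m) * Lq_norm M q f"
  proof (cases "Lq_norm M q f = 0")
    case True
    then show ?thesis using le[OF f] by simp
  next
    case False
    then have "Lq_norm M q f > 0" using Lq_norm_nonneg[of M q f] by simp
    then show ?thesis using upper[OF f] by (simp add: divide_le_eq)
  qed
qed

lemma Lq_onorm_le:
  assumes "0 \<le> K" and "\<And>f. f \<in> Lq_space M q \<Longrightarrow> Lq_norm M q (S f) \<le> K * Lq_norm M q f"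
  shows "Lq_onorm M q S \<le> K"
  unfolding Lq_onorm_def
proof (rule cSUP_least)
  have "(\<lambda>_. 0) \<in> Lq_space M q" by (simp add: Lq_space_def)
  then show "Lq_space M q \<noteq> {}" by blast
  fix f assume "f \<in> Lq_space M q"
  then show "Lq_norm M q (S f) / Lq_norm M q f \<le> K"
    using assms Lq_norm_nonneg[of M q f]
    by (cases "Lq_norm M q f = 0") (auto simp: divide_le_eq)
qed

lemma mult_op_power_comp: "(mult_op \<phi> ^^ n) \<circ> (id - mult_op \<phi>) = mult_op (\<lambda>\<omega>. \<phi> \<omega> ^ n * (1 - \<phi> \<omega>))"
proof -
  have "(mult_op \<phi> ^^ n) f = (\<lambda>\<omega>. \<phi> \<omega> ^ n * f \<omega>)" for f
    by (induction n) (auto simp: mult_op_def)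
  then show ?thesis
    by (simp add: fun_eq_iff mult_op_def algebra_simps)
qed

section \<open>Passing between pointwise bounds, weighted sums and decay\<close>

text \<open>Only the block \<open>N/2 \<le> n \<le> N\<close> is needed; there \<open>n powr (\<beta> - 1) \<ge> (N/2) powr \<beta> / N\<close>.\<close>

lemma sum_powr_ge:
  fixes \<beta> :: real
  assumes "\<beta> > 0" "N > 0"
  shows "2 powr (-\<beta> - 1) * real N powr \<beta> \<le> (\<Sum>n<N. real (Suc n) powr (\<beta> - 1))"
proof -
  have "2 powr (-\<beta> - 1) * real N powr \<beta> = (real N / 2) * ((real N / 2) powr \<beta> / real N)"
    using assms by (simp add: powr_divide powr_diff powr_minus field_simps)
  also have "\<dots> \<le> real (card {N div 2..<N}) * ((real N / 2) powr \<beta> / real N)"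
    by (intro mult_right_mono) auto
  also have "\<dots> = (\<Sum>n\<in>{N div 2..<N}. (real N / 2) powr \<beta> / real N)"
    by simp
  also have "\<dots> \<le> (\<Sum>n\<in>{N div 2..<N}. real (Suc n) powr (\<beta> - 1))"
  proof (rule sum_mono)
    fix n assume n: "n \<in> {N div 2..<N}"
    then have "real N / 2 \<le> real (Suc n)" by auto
    then have "(real N / 2) powr \<beta> \<le> real (Suc n) powr \<beta>"
      using assms by (intro powr_mono2) auto
    then have "(real N / 2) powr \<beta> / real N \<le> real (Suc n) powr \<beta> / real (Suc n)"
      using n by (intro frac_le) auto
    then show "(real N / 2) powr \<beta> / real N \<le> real (Suc n) powr (\<beta> - 1)"
      by (simp add: powr_diff)
  qed
  also have "\<dots> \<le> (\<Sum>n<N. real (Suc n) powr (\<beta> - 1))"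
    by (rule sum_mono2) auto
  finally show ?thesis .
qed

text \<open>This is the pointwise form of (ii). The p-th power of \<open>d\<close> contributes
  \<open>(1 - norm z) powr (\<alpha> * p)\<close>, which cancels the growth of the series exactly.
  If \<open>norm z = 1\<close>, then \<open>d\<close> forces \<open>z = 1\<close> and every term
  vanishes.\<close>

lemma suminf_powr_norm_le:
  fixes z :: complex
  assumes "1 \<le> p" "0 \<le> K" "0 \<le> C" and z: "norm z \<le> 1"
    and d: "norm (1 - z) \<le> K * (1 - norm z) powr \<alpha>"
    and sum: "\<And>r. 0 \<le> r \<Longrightarrow> r < 1 \<Longrightarrow>
      (\<Sum>n. ennreal (real (Suc n) powr (\<alpha> * p - 1) * r ^ Suc n)) \<le> ennreal (C * (1 - r) powr (-(\<alpha> * p)))"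
  shows "(\<Sum>n. ennreal (real (Suc n) powr (\<alpha> * p - 1) * norm (z ^ Suc n * (1 - z)) powr p))
    \<le> ennreal (C * K powr p)"
proof (cases "norm z = 1")
  case True
  then have "1 - z = 0" using d by simp
  then show ?thesis by simp
next
  case False
  define r where "r = norm z"
  have r: "0 \<le> r" "r < 1" using z False by (auto simp: r_def)
  have "norm (1 - z) powr p \<le> (K * (1 - r) powr \<alpha>) powr p"
    using d \<open>1 \<le> p\<close> by (intro powr_mono2) (auto simp: r_def)
  then have d': "norm (1 - z) powr p \<le> K powr p * (1 - r) powr (\<alpha> * p)"
    using assms r by (simp add: powr_mult powr_powr)
  have "(\<Sum>n. ennreal (real (Suc n) powr (\<alpha> * p - 1) * norm (z ^ Suc n * (1 - z)) powr p))
    \<le> (\<Sum>n. ennreal (real (Suc n) powr (\<alpha> * p - 1) * r ^ Suc n) * ennreal (K powr p * (1 - r) powr (\<alpha> * p)))"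
  proof (intro suminf_le)
    fix n
    have "(r ^ Suc n) powr p \<le> (r ^ Suc n) powr 1"
      using r \<open>1 \<le> p\<close> by (intro powr_mono') (auto simp del: power_Suc intro!: power_le_one)
    then have "(r ^ Suc n) powr p \<le> r ^ Suc n"
      using r by (simp del: power_Suc)
    then have "(r ^ Suc n) powr p * norm (1 - z) powr p \<le> r ^ Suc n * (K powr p * (1 - r) powr (\<alpha> * p))"
      using d' r by (intro mult_mono) (auto simp del: power_Suc)
    moreover have "norm (z ^ Suc n * (1 - z)) powr p = (r ^ Suc n) powr p * norm (1 - z) powr p"
      unfolding norm_mult norm_power r_def by (rule powr_mult)
    ultimately have "real (Suc n) powr (\<alpha> * p - 1) * norm (z ^ Suc n * (1 - z)) powr p
      \<le> real (Suc n) powr (\<alpha> * p - 1) * (r ^ Suc n * (K powr p * (1 - r) powr (\<alpha> * p)))"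
      by (intro mult_left_mono) auto
    then show "ennreal (real (Suc n) powr (\<alpha> * p - 1) * norm (z ^ Suc n * (1 - z)) powr p)
      \<le> ennreal (real (Suc n) powr (\<alpha> * p - 1) * r ^ Suc n) * ennreal (K powr p * (1 - r) powr (\<alpha> * p))"
      using r by (subst ennreal_mult'[symmetric]) (auto simp: mult.assoc intro!: ennreal_leI simp del: power_Suc)
  qed auto
  also have "\<dots> = (\<Sum>n. ennreal (real (Suc n) powr (\<alpha> * p - 1) * r ^ Suc n))
      * ennreal (K powr p * (1 - r) powr (\<alpha> * p))"
    by (rule ennreal_suminf_multc)
  also have "\<dots> \<le> ennreal (C * (1 - r) powr (-(\<alpha> * p))) * ennreal (K powr p * (1 - r) powr (\<alpha> * p))"
    by (intro mult_right_mono sum r) auto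
  also have "\<dots> = ennreal (C * K powr p)"
    using r \<open>0 \<le> C\<close> by (subst ennreal_mult'[symmetric]) (auto simp: powr_minus field_simps)
  finally show ?thesis .
qed

text \<open>Jensen turns each norm into an integral of \<open>norm (m n \<omega>) powr p\<close>
  against the density \<open>f\<close>. The sum then moves inside the integral, where the pointwise
  hypothesis bounds it by \<open>C\<close>.\<close>

lemma suminf_Lq_norm_mult_op_powr_le:
  assumes "1 \<le> q" "q \<le> p" "0 \<le> C"
    and m: "\<And>n. m n \<in> borel_measurable M" and bdd: "\<And>n. AE \<omega> in M. norm (m n \<omega>) \<le> B"
    and w: "\<And>n. 0 \<le> w n"
    and sum: "AE \<omega> in M. (\<Sum>n. ennreal (w n * norm (m n \<omega>) powr p)) \<le> ennreal C"
    and x: "x \<in> Lq_space M q"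
  shows "(\<Sum>n. ennreal (w n * Lq_norm M q (mult_op (m n) x) powr p)) \<le> ennreal (C * Lq_norm M q x powr p)"
proof -
  define s where "s = p / q"
  have s: "1 \<le> s" "q > 0" "p \<ge> 0" using assms by (auto simp: s_def)
  define f where "f = (\<lambda>\<omega>. norm (x \<omega>) powr q)"
  define F where "F = (\<integral>\<omega>. f \<omega> \<partial>M)"
  have f: "integrable M f" "\<And>\<omega>. 0 \<le> f \<omega>" and [measurable]: "x \<in> borel_measurable M"
    using x by (auto simp: Lq_space_def f_def)
  have [measurable]: "f \<in> borel_measurable M" unfolding f_def by measurable
  note [measurable] = m
  have F: "0 \<le> F" unfolding F_def using f by (auto intro!: Bochner_Integration.integral_nonneg)
  have int: "integrable M (\<lambda>\<omega>. norm (m n \<omega>) powr t * f \<omega>)" if "t \<ge> 0" for n t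
  proof (rule Bochner_Integration.integrable_bound)
    show "integrable M (\<lambda>\<omega>. B powr t * f \<omega>)" using f by simp
    show "AE \<omega> in M. norm (norm (m n \<omega>) powr t * f \<omega>) \<le> norm (B powr t * f \<omega>)"
      using bdd[of n] by eventually_elim
        (use that f in \<open>auto simp: abs_mult intro!: mult_right_mono powr_mono2\<close>)
  qed auto
  have term_le: "Lq_norm M q (mult_op (m n) x) powr p
      \<le> F powr (s - 1) * (\<integral>\<omega>. norm (m n \<omega>) powr p * f \<omega> \<partial>M)" for n
  proof -
    have eq: "(norm (m n \<omega>) powr q) powr s = norm (m n \<omega>) powr p" for \<omega>
      using s by (simp add: powr_powr s_def)
    have "(\<integral>\<omega>. norm (m n \<omega>) powr q * f \<omega> \<partial>M) powr s
      \<le> F powr (s - 1) * (\<integral>\<omega>. (norm (m n \<omega>) powr q) powr s * f \<omega> \<partial>M)"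
      unfolding F_def by (rule integral_mult_powr_le) (use s f int in \<open>auto simp: eq\<close>)
    then show ?thesis
      unfolding eq using s by (simp add: Lq_norm_powr norm_mult_op_powr s_def f_def)
  qed
  \<comment> \<open>Extended nonnegative integrals allow sum and integral to be interchanged before
    anything is known to be summable.\<close>
  have "(\<Sum>n. ennreal (w n * Lq_norm M q (mult_op (m n) x) powr p))
      \<le> (\<Sum>n. ennreal (F powr (s - 1)) * (\<integral>\<^sup>+\<omega>. ennreal (w n * norm (m n \<omega>) powr p) * ennreal (f \<omega>) \<partial>M))"
  proof (intro suminf_le)
    fix n
    have "w n * Lq_norm M q (mult_op (m n) x) powr p
        \<le> w n * (F powr (s - 1) * (\<integral>\<omega>. norm (m n \<omega>) powr p * f \<omega> \<partial>M))"
      by (intro mult_left_mono term_le w)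
    also have "\<dots> = F powr (s - 1) * (\<integral>\<omega>. w n * (norm (m n \<omega>) powr p * f \<omega>) \<partial>M)"
      by simp
    finally have "ennreal (w n * Lq_norm M q (mult_op (m n) x) powr p)
      \<le> ennreal (F powr (s - 1) * (\<integral>\<omega>. w n * (norm (m n \<omega>) powr p * f \<omega>) \<partial>M))"
      by (rule ennreal_leI)
    also have "\<dots> = ennreal (F powr (s - 1)) * ennreal (\<integral>\<omega>. w n * (norm (m n \<omega>) powr p * f \<omega>) \<partial>M)"
      by (rule ennreal_mult') simp
    also have "ennreal (\<integral>\<omega>. w n * (norm (m n \<omega>) powr p * f \<omega>) \<partial>M)
      = (\<integral>\<^sup>+\<omega>. ennreal (w n * (norm (m n \<omega>) powr p * f \<omega>)) \<partial>M)"
      by (rule nn_integral_eq_integral[symmetric]) (use int s w f in \<open>auto intro!: AE_I2\<close>)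
    also have "\<dots> = (\<integral>\<^sup>+\<omega>. ennreal (w n * norm (m n \<omega>) powr p) * ennreal (f \<omega>) \<partial>M)"
      using w f by (intro nn_integral_cong) (simp add: mult.assoc flip: ennreal_mult')
    finally show "ennreal (w n * Lq_norm M q (mult_op (m n) x) powr p)
      \<le> ennreal (F powr (s - 1)) * (\<integral>\<^sup>+\<omega>. ennreal (w n * norm (m n \<omega>) powr p) * ennreal (f \<omega>) \<partial>M)" .
  qed auto
  also have "\<dots> = ennreal (F powr (s - 1))
      * (\<integral>\<^sup>+\<omega>. (\<Sum>n. ennreal (w n * norm (m n \<omega>) powr p)) * ennreal (f \<omega>) \<partial>M)"
    by (subst ennreal_suminf_cmult, subst ennreal_suminf_multc[symmetric], subst nn_integral_suminf) auto
  also have "\<dots> \<le> ennreal (F powr (s - 1)) * (\<integral>\<^sup>+\<omega>. ennreal C * ennreal (f \<omega>) \<partial>M)"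
    by (intro mult_left_mono nn_integral_mono_AE)
      (use sum in \<open>auto elim!: eventually_mono intro!: mult_right_mono\<close>)
  also have "\<dots> = ennreal (F powr (s - 1)) * (ennreal C * ennreal F)"
    using nn_integral_eq_integral[of M f] f by (simp add: nn_integral_cmult F_def)
  also have "\<dots> = ennreal (C * (F * F powr (s - 1)))"
    using F \<open>0 \<le> C\<close> by (simp add: mult_ac flip: ennreal_mult')
  also have "F * F powr (s - 1) = Lq_norm M q x powr p"
    using F s by (simp add: powr_mult_base Lq_norm_powr s_def F_def f_def)
  finally show ?thesis .
qed

text \<open>By \<open>mono\<close> each of the first \<open>N\<close> values
  \<open>L (Suc n)\<close> is at least \<open>L N\<close>, and \<open>sum_powr_ge\<close> bounds the
  sum of their weights from below. The power of 2 inverts the constant found there; the p-th root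
  turns \<open>N powr (-(\<alpha> * p))\<close> into \<open>N powr (-\<alpha>)\<close>.\<close>

lemma decay_of_suminf_powr_le:
  assumes pos: "0 < \<alpha>" "0 < p" "0 \<le> C" "0 \<le> X" "0 < N"
    and L: "\<And>n. 0 \<le> L n" and mono: "\<And>n. n \<le> N \<Longrightarrow> L N \<le> L n"
    and sum: "(\<Sum>n. ennreal (real (Suc n) powr (\<alpha> * p - 1) * L (Suc n) powr p)) \<le> ennreal (C * X powr p)"
  shows "L N \<le> (C * 2 powr (\<alpha> * p + 1)) powr (1 / p) * real N powr (-\<alpha>) * X"
proof -
  define \<beta> where "\<beta> = \<alpha> * p"
  have \<beta>: "\<beta> > 0" using pos by (simp add: \<beta>_def)
  have "ennreal (\<Sum>n<N. real (Suc n) powr (\<beta> - 1) * L N powr p)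
      = (\<Sum>n<N. ennreal (real (Suc n) powr (\<beta> - 1) * L N powr p))"
    by (simp add: sum_ennreal)
  also have "\<dots> \<le> (\<Sum>n<N. ennreal (real (Suc n) powr (\<beta> - 1) * L (Suc n) powr p))"
    using pos L by (intro sum_mono ennreal_leI mult_left_mono powr_mono2 mono) auto
  also have "\<dots> \<le> (\<Sum>n. ennreal (real (Suc n) powr (\<beta> - 1) * L (Suc n) powr p))"
    by (rule sum_le_suminf) auto
  also have "\<dots> \<le> ennreal (C * X powr p)"
    using sum by (simp add: \<beta>_def)
  finally have "(\<Sum>n<N. real (Suc n) powr (\<beta> - 1) * L N powr p) \<le> C * X powr p"
    using pos by (subst (asm) ennreal_le_iff) auto
  then have "(\<Sum>n<N. real (Suc n) powr (\<beta> - 1)) * L N powr p \<le> C * X powr p"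
    by (simp add: sum_distrib_right)
  moreover have "2 powr (-\<beta> - 1) * real N powr \<beta> * L N powr p
      \<le> (\<Sum>n<N. real (Suc n) powr (\<beta> - 1)) * L N powr p"
    by (intro mult_right_mono sum_powr_ge \<beta> pos) auto
  ultimately have "2 powr (-\<beta> - 1) * real N powr \<beta> * L N powr p \<le> C * X powr p"
    by linarith
  then have "L N powr p \<le> C * 2 powr (\<beta> + 1) * real N powr (-\<beta>) * X powr p"
    using pos by (simp add: powr_minus powr_diff powr_add field_simps)
  then have "(L N powr p) powr (1 / p) \<le> (C * 2 powr (\<beta> + 1) * real N powr (-\<beta>) * X powr p) powr (1 / p)"
    using pos by (intro powr_mono2) auto
  then show ?thesis
    using pos L[of N] by (simp add: powr_mult powr_powr \<beta>_def)
qed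

theorem proposition6p3:
  fixes M :: "'a measure" and \<phi> :: "'a \<Rightarrow> complex" and p q \<alpha> :: real
    and T :: "('a \<Rightarrow> complex) \<Rightarrow> ('a \<Rightarrow> complex)"
  assumes "sigma_finite_measure M"
    and "\<phi> \<in> borel_measurable M"
    and "ess_range M \<phi> \<subseteq> cball 0 1"
    and "1 \<le> q" and "q \<le> p"
    and "T = mult_op \<phi>"
    and "0 < \<alpha>" and "\<alpha> < 1"
  shows "(\<lambda>n. Lq_onorm M q ((T ^^ n) \<circ> (id - T))) \<in> O(\<lambda>n. real n powr (- \<alpha>))
    \<longleftrightarrow> (\<exists>C>0. \<forall>x\<in>Lq_space M q.
          (\<Sum>n. ennreal (real (Suc n) powr (\<alpha> * p - 1)
                    * Lq_norm M q (((T ^^ Suc n) \<circ> (id - T)) x) powr p))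
          \<le> ennreal (C * Lq_norm M q x powr p))"
proof -
  define m where "m n = (\<lambda>\<omega>. \<phi> \<omega> ^ n * (1 - \<phi> \<omega>))" for n
  have T: "(T ^^ n) \<circ> (id - T) = mult_op (m n)" for n
    using assms(6) by (simp add: mult_op_power_comp m_def)
  have pq: "0 < q" "0 < p" "1 \<le> p" using assms by auto
  have m: "m n \<in> borel_measurable M" for n
    using assms(2) by (simp add: m_def)
  have "AE \<omega> in M. \<phi> \<omega> \<in> cball 0 1"
    by (rule AE_in_closed_of_ess_range) (use assms in auto)
  then have disc: "AE \<omega> in M. norm (\<phi> \<omega>) \<le> 1" by simp
  \<comment> \<open>This crude bound, uniform in \<open>n\<close>, makes all the operators bounded,
    so that \<open>Lq_onorm\<close> is a genuine supremum.\<close>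
  have bdd: "AE \<omega> in M. norm (m n \<omega>) \<le> 2" for n
    using disc
  proof eventually_elim
    case (elim \<omega>)
    have "norm (1 - \<phi> \<omega>) \<le> 2" using norm_triangle_ineq4[of 1 "\<phi> \<omega>"] elim by simp
    then have "norm (\<phi> \<omega>) ^ n * norm (1 - \<phi> \<omega>) \<le> 1 * 2"
      using elim by (intro mult_mono power_le_one) auto
    then show ?case by (simp add: m_def norm_mult norm_power)
  qed
  show ?thesis
    unfolding T
  proof (intro iffI)
    assume "(\<lambda>n. Lq_onorm M q (mult_op (m n))) \<in> O(\<lambda>n. real n powr (- \<alpha>))"
    then obtain c where c: "c > 0"
      and ev: "eventually (\<lambda>n. norm (Lq_onorm M q (mult_op (m n))) \<le> c * norm (real n powr (-\<alpha>))) sequentially"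
      by (rule landau_o.bigE)
    then obtain n\<^sub>1 where n\<^sub>1: "\<And>n. n \<ge> n\<^sub>1 \<Longrightarrow> Lq_onorm M q (mult_op (m n)) \<le> c * real n powr (-\<alpha>)"
      by (force simp: eventually_sequentially)
    \<comment> \<open>The successor ensures \<open>n\<^sub>0 > 0\<close>, as
      \<open>norm_one_minus_le_powr\<close> requires.\<close>
    define n\<^sub>0 where "n\<^sub>0 = Suc n\<^sub>1"
    \<comment> \<open>Countably many exponents \<open>n\<close> share one exceptional null set, so
      the decay holds for all of them at a fixed \<open>\<omega>\<close>.\<close>
    have decay: "AE \<omega> in M. \<forall>n\<ge>n\<^sub>0. norm (m n \<omega>) \<le> c * real n powr (-\<alpha>)"
    proof (subst AE_all_countable, intro allI)
      fix n
      show "AE \<omega> in M. n \<ge> n\<^sub>0 \<longrightarrow> norm (m n \<omega>) \<le> c * real n powr (-\<alpha>)"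
      proof (cases "n \<ge> n\<^sub>0")
        case True
        have "AE \<omega> in M. norm (m n \<omega>) \<le> c * real n powr (-\<alpha>)"
        proof (rule AE_norm_le_of_Lq_norm_mult_op_le[OF assms(1) m bdd _ pq(1)])
          fix f assume f: "f \<in> Lq_space M q"
          have "Lq_norm M q (mult_op (m n) f) \<le> Lq_onorm M q (mult_op (m n)) * Lq_norm M q f"
            by (rule Lq_norm_mult_op_le_onorm[OF m bdd _ pq(1) f]) simp
          also have "\<dots> \<le> c * real n powr (-\<alpha>) * Lq_norm M q f"
            using n\<^sub>1[of n] True by (intro mult_right_mono Lq_norm_nonneg) (auto simp: n\<^sub>0_def)
          finally show "Lq_norm M q (mult_op (m n) f) \<le> c * real n powr (-\<alpha>) * Lq_norm M q f" .
        qed (use c in auto)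
        then show ?thesis by simp
      qed simp
    qed
    obtain K where K: "K > 0" and Kbound: "\<And>z :: complex. norm z \<le> 1 \<Longrightarrow>
        (\<And>n. n \<ge> n\<^sub>0 \<Longrightarrow> norm z ^ n * norm (1 - z) \<le> c * real n powr (-\<alpha>)) \<Longrightarrow>
        norm (1 - z) \<le> K * (1 - norm z) powr \<alpha>"
      by (rule norm_one_minus_le_powr[of \<alpha> c n\<^sub>0]) (use assms c in \<open>auto simp: n\<^sub>0_def\<close>)
    obtain C where C: "C > 0" and Cbound: "\<And>r. 0 \<le> r \<Longrightarrow> r < 1 \<Longrightarrow>
        (\<Sum>n. ennreal (real (Suc n) powr (\<alpha> * p - 1) * r ^ Suc n)) \<le> ennreal (C * (1 - r) powr (-(\<alpha> * p)))"
      using suminf_powr_mult_power_le[OF mult_pos_pos[OF assms(7) pq(2)]] by blast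
    have sum: "AE \<omega> in M. (\<Sum>n. ennreal (real (Suc n) powr (\<alpha> * p - 1) * norm (m (Suc n) \<omega>) powr p))
        \<le> ennreal (C * K powr p)"
      using disc decay
    proof eventually_elim
      case (elim \<omega>)
      have "norm (1 - \<phi> \<omega>) \<le> K * (1 - norm (\<phi> \<omega>)) powr \<alpha>"
        by (rule Kbound) (use elim in \<open>auto simp: m_def norm_mult norm_power\<close>)
      then show ?case
        unfolding m_def using K C assms pq elim by (intro suminf_powr_norm_le Cbound) auto
    qed
    show "\<exists>C>0. \<forall>x\<in>Lq_space M q.
        (\<Sum>n. ennreal (real (Suc n) powr (\<alpha> * p - 1) * Lq_norm M q (mult_op (m (Suc n)) x) powr p))
        \<le> ennreal (C * Lq_norm M q x powr p)"
    proof (intro exI[of _ "C * K powr p"] conjI ballI)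
      fix x assume "x \<in> Lq_space M q"
      then show "(\<Sum>n. ennreal (real (Suc n) powr (\<alpha> * p - 1) * Lq_norm M q (mult_op (m (Suc n)) x) powr p))
        \<le> ennreal (C * K powr p * Lq_norm M q x powr p)"
        using C by (intro suminf_Lq_norm_mult_op_powr_le[OF assms(4,5) _ m bdd _ sum]) auto
    qed (use C K in auto)
  next
    assume "\<exists>C>0. \<forall>x\<in>Lq_space M q.
        (\<Sum>n. ennreal (real (Suc n) powr (\<alpha> * p - 1) * Lq_norm M q (mult_op (m (Suc n)) x) powr p))
        \<le> ennreal (C * Lq_norm M q x powr p)"
    then obtain C where C: "C > 0" and sum: "\<And>x. x \<in> Lq_space M q \<Longrightarrow>
        (\<Sum>n. ennreal (real (Suc n) powr (\<alpha> * p - 1) * Lq_norm M q (mult_op (m (Suc n)) x) powr p))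
        \<le> ennreal (C * Lq_norm M q x powr p)"
      by blast
    define D where "D = (C * 2 powr (\<alpha> * p + 1)) powr (1 / p)"
    \<comment> \<open>Because \<open>norm (\<phi> \<omega>) \<le> 1\<close> almost everywhere, the
      multipliers decrease in modulus as the exponent grows.\<close>
    have antimono: "Lq_norm M q (mult_op (m N) x) \<le> Lq_norm M q (mult_op (m n) x)"
      if "n \<le> N" "x \<in> Lq_space M q" for n N x
    proof (rule Lq_norm_mono[OF pq(1)])
      show "mult_op (m N) x \<in> Lq_space M q" "mult_op (m n) x \<in> Lq_space M q"
        using that pq by (auto intro!: mult_op_in_Lq_space[OF m bdd])
      show "AE \<omega> in M. norm (mult_op (m N) x \<omega>) \<le> norm (mult_op (m n) x \<omega>)"
        using disc by eventually_elim
          (use that in \<open>auto simp: mult_op_def m_def norm_mult norm_power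
            intro!: mult_right_mono power_decreasing\<close>)
    qed
    \<comment> \<open>The index 0 is left out because \<open>0 powr (-\<alpha>) = 0\<close>; the
      asymptotic bound ignores it.\<close>
    have "Lq_onorm M q (mult_op (m N)) \<le> D * real N powr (-\<alpha>)" if "N > 0" for N
    proof (rule Lq_onorm_le)
      fix x assume x: "x \<in> Lq_space M q"
      show "Lq_norm M q (mult_op (m N) x) \<le> D * real N powr (-\<alpha>) * Lq_norm M q x"
        unfolding D_def
        by (rule decay_of_suminf_powr_le[OF _ pq(2) _ _ that])
          (use assms C sum[OF x] antimono x in \<open>auto simp: Lq_norm_nonneg\<close>)
    qed (simp add: D_def)
    moreover have "0 \<le> Lq_onorm M q (mult_op (m N))" for N
      by (rule Lq_onorm_mult_op_nonneg[OF m bdd _ pq(1)]) simp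
    ultimately show "(\<lambda>n. Lq_onorm M q (mult_op (m n))) \<in> O(\<lambda>n. real n powr (- \<alpha>))"
      by (intro bigoI[of _ D]) (auto intro!: eventually_mono[OF eventually_gt_at_top[of 0]])
  qed
qed

end
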